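(* Let $\mathcal X$ be a $C^r$ vector field, $r\ge 2$, defined in a neighborhood of the origin of $\mathbb R^2$, with $\mathcal X(0)=0$ and such that $A:=D\mathcal X(0)$ satisfies $A\neq 0$, $A^2=0$. Let $q_0\ne 0$ span $K=\ker A$, and let $\mathcal R_{\mathcal X}$ be the distinguished eigendirection restriction associated with $q_0$, i.e. the scalar function defined near $0$ by $A\mathcal X(uq_0)=\mathcal R_{\mathcal X}(u)\,q_0$. Let $q_1$ be any vector with $Aq_1=q_0$, introduce coordinates $(u,v)$ by $z=uq_0+vq_1$, and write the system $\dot z=\mathcal X(z)$ in these coordinates as $$\dot u=v+\mathcal F(u,v),\qquad \dot v=\mathcal G(u,v),\qquad \mathcal F,\mathcal G=\mathcal O(\|(u,v)\|^2).$$ Then, for $u$ near $0$, $$\mathcal R_{\mathcal X}(u)=\mathcal G(u,0).$$ In particular, once $q_0$ is fixed, $\mathcal R_{\mathcal X}$ is independent of the choice of the generalized eigenvector $q_1$.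
   Context: Since $A$ is a nonzero $2\times 2$ real matrix with $A^2=0$, one has $\operatorname{rank}A=1$ and $\operatorname{im}A=\ker A=K$, a one-dimensional space. Hence the map $\rho_{\mathcal X}(\xi):=A\mathcal X(\xi)$, for $\xi\in K$ close to the origin, takes values in $K$; after choosing a generator $q_0$ of $K$ there is a unique scalar function $\mathcal R_{\mathcal X}$ near $0$ with $\rho_{\mathcal X}(uq_0)=\mathcal R_{\mathcal X}(u)q_0$, called the distinguished eigendirection restriction of $\mathcal X$ associated with $q_0$. *)

theory Defs
  imports "HOL-Analysis.Analysis" "HOL-Library.Landau_Symbols" "HOL-Library.Extended_Nat"
begin

text \<open>
  \<open>Ck_on k f U\<close>, for open \<open>U\<close>: the map \<open>f\<close> is \<open>k\<close> times continuously differentiable on \<open>U\<close>.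
  Only the values of \<open>f\<close> on \<open>U\<close> matter.
\<close>

fun Ck_on :: "nat \<Rightarrow> ('a::real_normed_vector \<Rightarrow> 'b::real_normed_vector) \<Rightarrow> 'a set \<Rightarrow> bool" where
  "Ck_on 0 f U \<longleftrightarrow> continuous_on U f"
| "Ck_on (Suc k) f U \<longleftrightarrow>
     (\<forall>x\<in>U. f differentiable (at x)) \<and>
     (\<forall>h. Ck_on k (\<lambda>x. frechet_derivative f (at x) h) U)"

text \<open>The order of smoothness \<open>r\<close> may be \<open>\<infinity>\<close>.\<close>

definition Cr_on :: "enat \<Rightarrow> ('a::real_normed_vector \<Rightarrow> 'b::real_normed_vector) \<Rightarrow> 'a set \<Rightarrow> bool" where
  "Cr_on r f U \<longleftrightarrow> (\<forall>k. enat k \<le> r \<longrightarrow> Ck_on k f U)"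

text \<open>
  The scalar function \<open>u \<mapsto> \<R>(u)\<close> given by \<open>A X(u q\<^sub>0) = \<R>(u) q\<^sub>0\<close>, where \<open>A = DX(0)\<close>.
  A vector field is a total function here, so only the germ of \<open>\<R>\<close> at \<open>0\<close> is meaningful.
\<close>

definition eigendirection_restriction :: "(real^2 \<Rightarrow> real^2) \<Rightarrow> real^2 \<Rightarrow> real \<Rightarrow> real" where
  "eigendirection_restriction X q0 u =
     (THE s. jacobian X (at 0) *v X (u *\<^sub>R q0) = s *\<^sub>R q0)"

lemma eigendirection_restriction_unique:
  fixes X :: "real^2 \<Rightarrow> real^2"
  assumes "jacobian X (at 0) ** jacobian X (at 0) = 0"
    and "q0 \<noteq> 0" and "span {q0} = {z. jacobian X (at 0) *v z = 0}"
  shows "\<exists>!s. jacobian X (at 0) *v X (u *\<^sub>R q0) = s *\<^sub>R q0"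
proof -
  let ?A = "jacobian X (at 0)"
  have "?A *v (?A *v X (u *\<^sub>R q0)) = 0"
    using assms(1) by (simp add: matrix_vector_mul_assoc)
  then have "?A *v X (u *\<^sub>R q0) \<in> span {q0}"
    using assms(3) by simp
  then obtain s where "?A *v X (u *\<^sub>R q0) = s *\<^sub>R q0"
    by (auto simp: span_singleton)
  with assms(2) show ?thesis by auto
qed

lemma eigendirection_restriction_works:
  fixes X :: "real^2 \<Rightarrow> real^2"
  assumes "jacobian X (at 0) ** jacobian X (at 0) = 0"
    and "q0 \<noteq> 0" and "span {q0} = {z. jacobian X (at 0) *v z = 0}"
  shows "jacobian X (at 0) *v X (u *\<^sub>R q0) = eigendirection_restriction X q0 u *\<^sub>R q0"
  unfolding eigendirection_restriction_def
  by (rule theI' [OF eigendirection_restriction_unique [OF assms]])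

text \<open>
  Near the origin, the system \<open>z' = X(z)\<close> reads \<open>u' = v + F(u,v)\<close>, \<open>v' = G(u,v)\<close> in the
  coordinates \<open>z = u q\<^sub>0 + v q\<^sub>1\<close>: since \<open>z' = u' q\<^sub>0 + v' q\<^sub>1\<close>, this says that \<open>v + F(u,v)\<close> and
  \<open>G(u,v)\<close> are the components of \<open>X(u q\<^sub>0 + v q\<^sub>1)\<close> in the basis \<open>q\<^sub>0, q\<^sub>1\<close>.
\<close>

definition system_in_coordinates ::
  "(real^2 \<Rightarrow> real^2) \<Rightarrow> real^2 \<Rightarrow> real^2 \<Rightarrow> (real \<times> real \<Rightarrow> real) \<Rightarrow> (real \<times> real \<Rightarrow> real) \<Rightarrow> bool" where
  "system_in_coordinates X q0 q1 F G \<longleftrightarrow>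
     (\<forall>\<^sub>F (u, v) in nhds (0, 0).
        X (u *\<^sub>R q0 + v *\<^sub>R q1) = (v + F (u, v)) *\<^sub>R q0 + G (u, v) *\<^sub>R q1)"

end

theory Submission
  imports Defs
begin

text \<open>
  The argument has an analytic and an algebraic half. On the analytic side, the remainder
  \<open>X z - A z\<close> of a \<open>C\<^sup>2\<close> field at its zero is bounded by a multiple of \<open>(norm z)\<^sup>2\<close>
  (\<open>second_order_remainder\<close>). On the algebraic side, \<open>A q\<^sub>0 = 0\<close> and \<open>A q\<^sub>1 = q\<^sub>0\<close> make
  \<open>q\<^sub>0, q\<^sub>1\<close> a Jordan basis of the plane (\<open>jordan_chain_bij\<close>), and in its coordinates the linear
  part \<open>A (u q\<^sub>0 + v q\<^sub>1) = v q\<^sub>0\<close> is exactly the term \<open>v\<close> in the equation for \<open>u\<close>. So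
  \<open>F\<close> and \<open>G\<close> are the coordinates of the remainder, and inherit its quadratic bound.

  Finally, applying \<open>A\<close> to \<open>X (u q\<^sub>0) = F(u,0) q\<^sub>0 + G(u,0) q\<^sub>1\<close> kills the first summand and
  turns the second into \<open>G(u,0) q\<^sub>0\<close>; comparison with the definition of the restriction gives
  \<open>G(u,0)\<close>. The restriction does not mention \<open>q\<^sub>1\<close>, hence neither does the germ of \<open>G(u,0)\<close>.
\<close>

lemma differentiable_imp_pointwise_lipschitz:
  fixes f :: "'a::real_normed_vector \<Rightarrow> 'b::real_normed_vector"
  assumes "f differentiable (at a)"
  shows "\<exists>C\<ge>0. \<forall>\<^sub>F x in nhds a. norm (f x - f a) \<le> C * norm (x - a)"
proof -
  obtain f' where f': "(f has_derivative f') (at a)"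
    using assms by (auto simp: differentiable_def)
  then have "bounded_linear f'"
    by (rule has_derivative_bounded_linear)
  then obtain K where K: "K > 0" "\<And>x. norm (f' x) \<le> norm x * K"
    using bounded_linear.pos_bounded by blast
  obtain d where d: "d > 0"
      "\<And>y. norm (y - a) < d \<Longrightarrow> norm (f y - f a - f' (y - a)) \<le> 1 * norm (y - a)"
    using f' zero_less_one unfolding has_derivative_at_alt by meson
  have "norm (f y - f a) \<le> (1 + K) * norm (y - a)" if "dist y a < d" for y
  proof -
    have "norm (f y - f a) \<le> norm (f y - f a - f' (y - a)) + norm (f' (y - a))"
      by (rule order_trans [OF _ norm_triangle_ineq]) simp
    also have "\<dots> \<le> 1 * norm (y - a) + norm (y - a) * K"
      using that by (intro add_mono d K) (simp add: dist_norm)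
    finally show ?thesis
      by (simp add: algebra_simps)
  qed
  then show ?thesis
    using K(1) d(1) by (intro exI [of _ "1 + K"]) (auto simp: eventually_nhds_metric)
qed

text \<open>
  A linear map on a Euclidean space is controlled by its values on the standard basis. This turns
  differentiability of \<open>\<lambda>x. f' x h\<close> for each fixed direction \<open>h\<close> into a bound on \<open>f'\<close> in operator
  norm.
\<close>

lemma onorm_le_sum_Basis:
  fixes L :: "'a::euclidean_space \<Rightarrow> 'b::real_normed_vector"
  assumes "linear L"
  shows "onorm L \<le> (\<Sum>b\<in>Basis. norm (L b))"
proof (rule onorm_bound)
  fix x :: 'a
  have "L x = (\<Sum>b\<in>Basis. (x \<bullet> b) *\<^sub>R L b)"
    using assms by (subst euclidean_representation [of x, symmetric])
      (simp only: linear_sum linear_scale)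
  then have "norm (L x) \<le> (\<Sum>b\<in>Basis. \<bar>x \<bullet> b\<bar> * norm (L b))"
    using norm_sum [of "\<lambda>b. (x \<bullet> b) *\<^sub>R L b" Basis] by simp
  also have "\<dots> \<le> (\<Sum>b\<in>Basis. norm x * norm (L b))"
    by (intro sum_mono mult_right_mono) (auto simp: Basis_le_norm)
  finally show "norm (L x) \<le> (\<Sum>b\<in>Basis. norm (L b)) * norm x"
    by (simp add: sum_distrib_left mult.commute)
qed (simp add: sum_nonneg)

text \<open>
  Differentiability of the derivative at \<open>a\<close> gives \<open>onorm (f' x - f' a) \<le> C * norm (x - a)\<close> nearby.
  The mean value inequality for \<open>f - f' a\<close> on the ball of radius \<open>norm (x - a)\<close> then contributes
  the second factor \<open>norm (x - a)\<close>.
\<close>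

lemma second_order_remainder:
  fixes f :: "'a::euclidean_space \<Rightarrow> 'b::real_normed_vector"
  assumes "open U" and "a \<in> U"
    and diff: "\<And>x. x \<in> U \<Longrightarrow> f differentiable (at x)"
    and diff2: "\<And>h. (\<lambda>x. frechet_derivative f (at x) h) differentiable (at a)"
  shows "\<exists>C\<ge>0. \<forall>\<^sub>F x in nhds a.
           norm (f x - f a - frechet_derivative f (at a) (x - a)) \<le> C * (norm (x - a))\<^sup>2"
proof -
  define D where "D x = frechet_derivative f (at x)" for x
  have D: "(f has_derivative D x) (at x)" if "x \<in> U" for x
    using diff [OF that] by (simp add: D_def frechet_derivative_works)
  have "\<forall>h. \<exists>C\<ge>0. \<forall>\<^sub>F x in nhds a. norm (D x h - D a h) \<le> C * norm (x - a)"
    using differentiable_imp_pointwise_lipschitz [OF diff2] by (simp add: D_def)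
  then obtain c where c: "\<And>h. c h \<ge> 0"
      "\<And>h. \<forall>\<^sub>F x in nhds a. norm (D x h - D a h) \<le> c h * norm (x - a)"
    by metis
  define C where "C = (\<Sum>b\<in>Basis. c b)"
  have C: "C \<ge> 0"
    unfolding C_def by (intro sum_nonneg c)
  have "\<forall>\<^sub>F x in nhds a. x \<in> U \<and> (\<forall>b\<in>Basis. norm (D x b - D a b) \<le> c b * norm (x - a))"
    using assms(1,2) c(2)
    by (intro eventually_conj eventually_nhds_in_open eventually_ball_finite) auto
  then obtain d where d: "d > 0" "\<And>x. dist x a < d \<Longrightarrow> x \<in> U"
      "\<And>x b. dist x a < d \<Longrightarrow> b \<in> Basis \<Longrightarrow> norm (D x b - D a b) \<le> c b * norm (x - a)"
    unfolding eventually_nhds_metric by blast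
  have lin: "bounded_linear (D x)" if "dist x a < d" for x
    using D [OF d(2) [OF that]] by (rule has_derivative_bounded_linear)
  have a: "dist a a < d" using d(1) by simp
  have "norm (f x - f a - D a (x - a)) \<le> C * (norm (x - a))\<^sup>2" if x: "dist x a < d" for x
  proof -
    let ?B = "cball a (norm (x - a))"
    have near: "dist y a < d" if "y \<in> ?B" for y
      using that x by (simp add: dist_norm norm_minus_commute)
    have "norm ((f x - D a x) - (f a - D a a)) \<le> C * norm (x - a) * norm (x - a)"
    proof (rule differentiable_bound [where S = ?B and f = "\<lambda>y. f y - D a y"
          and f' = "\<lambda>y h. D y h - D a h"])
      fix y assume y: "y \<in> ?B"
      show "((\<lambda>y. f y - D a y) has_derivative (\<lambda>h. D y h - D a h)) (at y within ?B)"
        using D [OF d(2) [OF near [OF y]]] lin [OF a]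
        by (intro has_derivative_diff has_derivative_at_withinI [OF bounded_linear_imp_has_derivative])
          (auto intro: has_derivative_at_withinI)
      have "linear (\<lambda>h. D y h - D a h)"
        using lin [OF near [OF y]] lin [OF a]
        by (intro bounded_linear.linear bounded_linear_sub)
      then have "onorm (\<lambda>h. D y h - D a h) \<le> (\<Sum>b\<in>Basis. norm (D y b - D a b))"
        by (rule onorm_le_sum_Basis)
      also have "\<dots> \<le> (\<Sum>b\<in>Basis. c b * norm (y - a))"
        by (intro sum_mono d(3) near y)
      also have "\<dots> = C * norm (y - a)"
        by (simp add: C_def sum_distrib_right)
      also have "\<dots> \<le> C * norm (x - a)"
        using y C by (intro mult_left_mono) (simp_all add: dist_norm norm_minus_commute)
      finally show "onorm (\<lambda>h. D y h - D a h) \<le> C * norm (x - a)" .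
    qed (auto simp: dist_norm norm_minus_commute)
    moreover have "f x - f a - D a (x - a) = (f x - D a x) - (f a - D a a)"
      using lin [OF a] by (simp add: linear_diff bounded_linear.linear)
    ultimately show ?thesis
      by (simp only: power2_eq_square mult.assoc)
  qed
  then show ?thesis
    using C d(1) by (auto simp: eventually_nhds_metric D_def)
qed

lemma C2_vector_field_remainder:
  fixes X :: "real^'n \<Rightarrow> real^'n"
  assumes "open U" and "0 \<in> U" and "r \<ge> 2" and "Cr_on r X U" and "X 0 = 0"
  shows "\<exists>C\<ge>0. \<forall>\<^sub>F z in nhds 0. norm (X z - jacobian X (at 0) *v z) \<le> C * (norm z)\<^sup>2"
proof -
  have "Ck_on (Suc (Suc 0)) X U"
    using assms(3,4) by (simp add: Cr_on_def numeral_2_eq_2 [symmetric] numeral_eq_enat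
        del: Ck_on.simps)
  then have diff: "\<And>x. x \<in> U \<Longrightarrow> X differentiable (at x)"
    and diff2: "\<And>h. (\<lambda>x. frechet_derivative X (at x) h) differentiable (at 0)"
    using assms(2) by auto
  have "frechet_derivative X (at 0) = (*v) (jacobian X (at 0))"
    using diff [OF assms(2)] by (intro frechet_derivative_at [symmetric]) (simp add: jacobian_works)
  then show ?thesis
    using second_order_remainder [OF assms(1,2) diff diff2] assms(5) by simp
qed

text \<open>
  Independence of \<open>q\<^sub>0, q\<^sub>1\<close>: applying \<open>A\<close> to a vanishing combination isolates the coefficient
  of \<open>q\<^sub>1\<close>.
\<close>

lemma jordan_chain_bij:
  fixes A :: "real^2^2"
  assumes "q0 \<noteq> 0" and "A *v q0 = 0" and "A *v q1 = q0"
  shows "linear (\<lambda>(u::real, v::real). u *\<^sub>R q0 + v *\<^sub>R q1)" (is "linear ?P")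
    and "bij (\<lambda>(u::real, v::real). u *\<^sub>R q0 + v *\<^sub>R q1)"
proof -
  show lin: "linear ?P"
    by (rule linearI) (auto simp: algebra_simps)
  have "u = 0 \<and> v = 0" if "u *\<^sub>R q0 + v *\<^sub>R q1 = 0" for u v
  proof -
    have "A *v (u *\<^sub>R q0 + v *\<^sub>R q1) = v *\<^sub>R q0"
      using assms(2,3) by (simp add: matrix_vector_right_distrib matrix_vector_mult_scaleR)
    with that assms(1) show ?thesis by auto
  qed
  then have inj: "inj ?P"
    unfolding linear_injective_0 [OF lin] by (auto simp: zero_prod_def)
  then have "surj ?P"
    by (intro linear_injective_imp_surjective [OF lin]) simp_all
  with inj show "bij ?P"
    by (simp add: bij_def)
qed

text \<open>
  The two coordinates of the remainder are controlled simultaneously, because an injective linear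
  map on a finite-dimensional space is bounded below.
\<close>

lemma coordinates_quadratic:
  fixes X :: "real^2 \<Rightarrow> real^2"
  assumes "open U" and "0 \<in> U" and "r \<ge> 2" and "Cr_on r X U" and "X 0 = 0"
    and "q0 \<noteq> 0" and q0: "jacobian X (at 0) *v q0 = 0" and q1: "jacobian X (at 0) *v q1 = q0"
    and sys: "system_in_coordinates X q0 q1 F G"
  shows "F \<in> O[nhds (0, 0)](\<lambda>p. (norm p)\<^sup>2)" and "G \<in> O[nhds (0, 0)](\<lambda>p. (norm p)\<^sup>2)"
proof -
  define A where "A = jacobian X (at 0)"
  define P where "P = (\<lambda>(u::real, v::real). u *\<^sub>R q0 + v *\<^sub>R q1)"
  have lin: "linear P" and "inj P"
    using jordan_chain_bij [OF \<open>q0 \<noteq> 0\<close> q0 q1] by (auto simp: P_def bij_def)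
  then obtain B where B: "B > 0" "\<And>p. B * norm p \<le> norm (P p)"
    using linear_inj_bounded_below_pos by blast
  obtain K where K: "K > 0" "\<And>p. norm (P p) \<le> K * norm p"
    using linear_bounded_pos [OF lin] by blast
  obtain C where C: "C \<ge> 0" "\<forall>\<^sub>F z in nhds 0. norm (X z - A *v z) \<le> C * (norm z)\<^sup>2"
    using C2_vector_field_remainder [OF assms(1-5)] unfolding A_def by blast
  have "P 0 = 0"
    using lin by (rule linear_0)
  then have "filterlim P (nhds 0) (nhds 0)"
    using linear_continuous_at [of P 0] lin tendsto_at_iff_tendsto_nhds [of P 0]
    by (simp add: isCont_def linear_conv_bounded_linear)
  with C(2) have "\<forall>\<^sub>F p in nhds 0. norm (X (P p) - A *v P p) \<le> C * (norm (P p))\<^sup>2"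
    by (rule eventually_compose_filterlim)
  moreover have "\<forall>\<^sub>F p in nhds 0. X (P p) = (snd p + F p) *\<^sub>R q0 + G p *\<^sub>R q1"
    using sys by (simp add: system_in_coordinates_def P_def case_prod_unfold zero_prod_def)
  ultimately have ev: "\<forall>\<^sub>F p in nhds 0. norm (F p, G p) \<le> C * K\<^sup>2 / B * (norm p)\<^sup>2"
  proof eventually_elim
    case (elim p)
    have "A *v P p = snd p *\<^sub>R q0"
      using q0 q1 by (simp add: P_def A_def case_prod_unfold matrix_vector_right_distrib
          matrix_vector_mult_scaleR)
    with elim(2) have "P (F p, G p) = X (P p) - A *v P p"
      by (simp add: P_def algebra_simps)
    then have "B * norm (F p, G p) \<le> C * (norm (P p))\<^sup>2"
      using B(2) [of "(F p, G p)"] elim(1) by simp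
    also have "\<dots> \<le> C * (K * norm p)\<^sup>2"
      using C(1) K(2) by (intro mult_left_mono power_mono) auto
    finally show ?case
      using B(1) by (simp add: field_simps power_mult_distrib)
  qed
  have comp: "norm (F p) \<le> norm (F p, G p)" "norm (G p) \<le> norm (F p, G p)" for p
    using norm_fst_le [of "F p" "G p"] norm_snd_le [of "G p" "F p"] by auto
  have bigo: "f \<in> O[nhds (0, 0)](\<lambda>p. (norm p)\<^sup>2)"
    if "\<And>p. norm (f p) \<le> norm (F p, G p)" for f :: "real \<times> real \<Rightarrow> real"
  proof (rule bigoI [where c = "C * K\<^sup>2 / B"])
    show "\<forall>\<^sub>F p in nhds (0, 0). norm (f p) \<le> C * K\<^sup>2 / B * norm ((norm p)\<^sup>2)"
      using ev unfolding zero_prod_def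
      by eventually_elim (use that order_trans in fastforce)
  qed
  show "F \<in> O[nhds (0, 0)](\<lambda>p. (norm p)\<^sup>2)" "G \<in> O[nhds (0, 0)](\<lambda>p. (norm p)\<^sup>2)"
    using comp by (auto intro: bigo)
qed

text \<open>
  Applying \<open>A\<close> shifts the \<open>q\<^sub>1\<close>-component of \<open>X (u q\<^sub>0)\<close> onto \<open>q\<^sub>0\<close> and annihilates the
  \<open>q\<^sub>0\<close>-component, so only \<open>G\<close> survives.
\<close>

lemma eigendirection_restriction_eq_coordinate:
  fixes X :: "real^2 \<Rightarrow> real^2"
  assumes "q0 \<noteq> 0" and q0: "jacobian X (at 0) *v q0 = 0" and q1: "jacobian X (at 0) *v q1 = q0"
    and sys: "system_in_coordinates X q0 q1 F G"
  shows "\<forall>\<^sub>F u in nhds 0. eigendirection_restriction X q0 u = G (u, 0)"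
proof -
  have "((\<lambda>u. (u, 0)) \<longlongrightarrow> (0, 0)) (nhds (0::real))"
    by (intro tendsto_intros filterlim_ident)
  with sys have "\<forall>\<^sub>F u in nhds 0. X (u *\<^sub>R q0) = F (u, 0) *\<^sub>R q0 + G (u, 0) *\<^sub>R q1"
    unfolding system_in_coordinates_def by (auto dest: eventually_compose_filterlim)
  then show ?thesis
  proof eventually_elim
    case (elim u)
    then have "jacobian X (at 0) *v X (u *\<^sub>R q0) = G (u, 0) *\<^sub>R q0"
      using q0 q1 by (simp add: matrix_vector_right_distrib matrix_vector_mult_scaleR)
    then show ?case
      unfolding eigendirection_restriction_def using \<open>q0 \<noteq> 0\<close> by (intro the_equality) auto
  qed
qed

lemma system_in_coordinates_exists:
  assumes "surj (\<lambda>(u::real, v::real). u *\<^sub>R q0 + v *\<^sub>R q1)"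
  shows "\<exists>F G. system_in_coordinates X q0 q1 F G"
proof -
  have "\<forall>p. \<exists>s t. X (fst p *\<^sub>R q0 + snd p *\<^sub>R q1) = s *\<^sub>R q0 + t *\<^sub>R q1"
    using assms by (auto simp: surj_def)
  then obtain s t where
    st: "\<And>p. X (fst p *\<^sub>R q0 + snd p *\<^sub>R q1) = s p *\<^sub>R q0 + t p *\<^sub>R q1"
    by metis
  have "system_in_coordinates X q0 q1 (\<lambda>p. s p - snd p) t"
    using st by (auto simp: system_in_coordinates_def case_prod_unfold)
  then show ?thesis by blast
qed

theorem proposition2p2:
  fixes X :: "real^2 \<Rightarrow> real^2" and U :: "(real^2) set" and r :: enat and q0 :: "real^2"
  assumes "open U" and "0 \<in> U"
    and "r \<ge> 2" and "Cr_on r X U"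
    and "X 0 = 0"
    and "jacobian X (at 0) \<noteq> 0"
    and "jacobian X (at 0) ** jacobian X (at 0) = 0"
    and "q0 \<noteq> 0" and "span {q0} = {z. jacobian X (at 0) *v z = 0}"
  shows "(\<forall>q1. jacobian X (at 0) *v q1 = q0 \<longrightarrow>
            bij (\<lambda>(u::real, v::real). u *\<^sub>R q0 + v *\<^sub>R q1) \<and>
            (\<exists>F G. system_in_coordinates X q0 q1 F G) \<and>
            (\<forall>F G. system_in_coordinates X q0 q1 F G \<longrightarrow>
               F \<in> O[nhds (0, 0)](\<lambda>p. (norm p)\<^sup>2) \<and>
               G \<in> O[nhds (0, 0)](\<lambda>p. (norm p)\<^sup>2) \<and>
               (\<forall>\<^sub>F u in nhds 0. eigendirection_restriction X q0 u = G (u, 0)))) \<and>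
         (\<forall>q1 q1' F G F' G'.
            jacobian X (at 0) *v q1 = q0 \<longrightarrow> jacobian X (at 0) *v q1' = q0 \<longrightarrow>
            system_in_coordinates X q0 q1 F G \<longrightarrow> system_in_coordinates X q0 q1' F' G' \<longrightarrow>
            (\<forall>\<^sub>F u in nhds 0. G (u, 0) = G' (u, 0)))"
proof -
  have q0: "jacobian X (at 0) *v q0 = 0"
    using assms(9) span_base [of q0 "{q0}"] by auto
  note restriction = eigendirection_restriction_eq_coordinate [OF assms(8) q0]
  show ?thesis
  proof (rule conjI; intro allI impI)
    fix q1 assume q1: "jacobian X (at 0) *v q1 = q0"
    have bij: "bij (\<lambda>(u::real, v::real). u *\<^sub>R q0 + v *\<^sub>R q1)"
      using assms(8) q0 q1 by (rule jordan_chain_bij(2))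
    show "bij (\<lambda>(u::real, v::real). u *\<^sub>R q0 + v *\<^sub>R q1) \<and>
        (\<exists>F G. system_in_coordinates X q0 q1 F G) \<and>
        (\<forall>F G. system_in_coordinates X q0 q1 F G \<longrightarrow>
           F \<in> O[nhds (0, 0)](\<lambda>p. (norm p)\<^sup>2) \<and>
           G \<in> O[nhds (0, 0)](\<lambda>p. (norm p)\<^sup>2) \<and>
           (\<forall>\<^sub>F u in nhds 0. eigendirection_restriction X q0 u = G (u, 0)))"
      using bij system_in_coordinates_exists [OF bij_is_surj [OF bij]] restriction [OF q1]
        coordinates_quadratic [OF assms(1-5) assms(8) q0 q1]
      by simp
  next
    fix q1 q1' F G F' G'
    assume "jacobian X (at 0) *v q1 = q0" "jacobian X (at 0) *v q1' = q0"
      and "system_in_coordinates X q0 q1 F G" "system_in_coordinates X q0 q1' F' G'"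
    then have "\<forall>\<^sub>F u in nhds 0. eigendirection_restriction X q0 u = G (u, 0)"
      and "\<forall>\<^sub>F u in nhds 0. eigendirection_restriction X q0 u = G' (u, 0)"
      using restriction by blast+
    then show "\<forall>\<^sub>F u in nhds 0. G (u, 0) = G' (u, 0)"
      by eventually_elim simp
  qed
qed

end
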